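(* Let $q$ be a prime power, $k\geq 3$ with $k\mid(q-1)$, $m=(q-1)/k$, $F=\mathrm{GF}(q)$, $\zeta$ a generator of $F^{*}$, $\varphi=\zeta^{m}$, and $\Phi=\langle\varphi\rangle$ the subgroup of order $k$. For $a,c\in F^{*}$ let $[a,c]_{k}=|\Phi\cap(\Phi a+c)|$, and for $i,j\in\{1,\dots,k-1\}$ let $c_{j,i}=(\varphi^{j}-1)^{-1}(\varphi^{i}-1)$, where indices are read modulo $k$ and represented in $\{0,1,\dots,k-1\}$. Let $a,c\in F^{*}$. Then (1) $[a,c]_{k}>0$ if and only if $a\in\Phi(\psi-c)$ for some $\psi\in\Phi\setminus\{c\}$; (2) $[a,c]_{k}\geq 2$ if and only if $a\in\Phi c_{j,i}$ and $c\in\Phi c_{j,j-i}$ for some $i,j\in\{1,\dots,k-1\}$ with $i\neq j$. *)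

theory Defs
  imports Complex_Main "HOL-Library.Cardinality" "HOL-Number_Theory.Prime_Powers"
begin

definition cyclic_subgroup :: "'a::field \<Rightarrow> 'a set" where
  "cyclic_subgroup x = range (\<lambda>n::int. x powi n)"

text \<open>A generator is automatically nonzero, as \<open>0 powi 1 = 0\<close> is excluded from the right-hand side.\<close>

definition generates_units :: "'a::field \<Rightarrow> bool" where
  "generates_units x \<longleftrightarrow> cyclic_subgroup x = UNIV - {0}"

definition mult_coset :: "'a::field set \<Rightarrow> 'a \<Rightarrow> 'a set" where
  "mult_coset H x = (\<lambda>h. h * x) ` H"

text \<open>The number \<open>[a,c]\<^sub>k\<close>, with \<open>H\<close> the subgroup of order \<open>k\<close>.\<close>

definition bracket :: "'a::field set \<Rightarrow> 'a \<Rightarrow> 'a \<Rightarrow> nat" where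
  "bracket H a c = card (H \<inter> (\<lambda>x. x + c) ` mult_coset H a)"

text \<open>The element \<open>c\<^sub>j\<^sub>,\<^sub>i\<close>. Indices are integers, so that \<open>j - i\<close> is not truncated,
  and are reduced to \<open>{0..k-1}\<close> before use as exponents.\<close>

definition cconst :: "'a::field \<Rightarrow> nat \<Rightarrow> int \<Rightarrow> int \<Rightarrow> 'a" where
  "cconst g k j i = inverse (g ^ nat (j mod int k) - 1) * (g ^ nat (i mod int k) - 1)"

end

theory Submission
  imports Defs
begin

text \<open>
  Two elements of \<open>\<Phi> \<inter> (\<Phi> a + c)\<close> are \<open>h a + c = \<psi>\<close> and
  \<open>h \<phi>\<^sup>j a + c = \<psi> \<phi>\<^sup>i\<close> with \<open>h, \<psi> \<in> \<Phi>\<close> and \<open>\<phi>\<^sup>i, \<phi>\<^sup>j \<noteq> 1\<close>. This pair of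
  linear equations has the unique solution \<open>a = \<psi> h\<^sup>-\<^sup>1 (\<phi>\<^sup>i - 1) / (\<phi>\<^sup>j - 1)\<close>,
  \<open>c = \<psi> \<phi>\<^sup>i (\<phi>\<^sup>j\<^sup>-\<^sup>i - 1) / (\<phi>\<^sup>j - 1)\<close>. Since \<open>\<psi>\<close> and \<open>h\<close> are independent, the two
  factors from \<open>\<Phi>\<close> are arbitrary, and \<open>c \<noteq> 0\<close> says that \<open>i \<noteq> j\<close>.
\<close>

section \<open>Orders of a generator of the unit group and of its powers\<close>

text \<open>
  The library's \<open>finite_field_power_card_eq_same\<close> does not apply, as the sort \<open>{field, finite}\<close>
  is not contained in the class \<open>finite_field\<close>.
\<close>

lemma power_card_minus_1_eq_1:
  fixes x :: "'a::{field,finite}"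
  assumes "x \<noteq> 0"
  shows "x ^ (CARD('a) - 1) = 1"
proof -
  let ?U = "UNIV - {0::'a}"
  \<comment> \<open>Multiplication by \<open>x\<close> permutes the units, so it preserves their
    product, which is nonzero and can be cancelled.\<close>
  have "(\<Prod>y\<in>?U. y) = (\<Prod>y\<in>?U. x * y)"
    by (rule prod.reindex_bij_witness[of _ "\<lambda>y. x * y" "\<lambda>y. y / x"]) (use assms in auto)
  also have "\<dots> = x ^ card ?U * (\<Prod>y\<in>?U. y)"
    by (simp add: prod.distrib)
  finally have "x ^ card ?U * (\<Prod>y\<in>?U. y) = 1 * (\<Prod>y\<in>?U. y)"
    by simp
  moreover have "(\<Prod>y\<in>?U. y) \<noteq> 0"
    by simp
  ultimately show ?thesis
    by (simp add: card_Diff_singleton)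
qed

lemma power_int_mod_eq:
  fixes x :: "'a::field"
  assumes "x \<noteq> 0" "x powi d = 1"
  shows "x powi (n mod d) = x powi n"
proof -
  have "x powi n = x powi (d * (n div d) + n mod d)"
    by simp
  also have "\<dots> = (x powi d) powi (n div d) * x powi (n mod d)"
    using assms(1) by (subst power_int_add) (simp_all only: power_int_mult simp_thms)
  finally show ?thesis
    using assms(2) by simp
qed

lemma generates_units_nonzero:
  assumes "generates_units x"
  shows "x \<noteq> 0"
proof -
  have "x powi 1 \<in> UNIV - {0}"
    using assms unfolding generates_units_def cyclic_subgroup_def by blast
  then show ?thesis
    by simp
qed

text \<open>The exponent \<open>CARD('a) - 1\<close> kills every unit, and no smaller positive
  exponent kills a generator. Division with remainder then gives the divisibility.\<close>

lemma generates_units_power_int_eq_1_iff: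
  fixes x :: "'a::{field,finite}"
  assumes gen: "generates_units x"
  shows "x powi n = 1 \<longleftrightarrow> int (CARD('a) - 1) dvd n"
proof -
  let ?N = "int (CARD('a) - 1)"
  have x0: "x \<noteq> 0"
    using gen by (rule generates_units_nonzero)
  have xN: "x powi ?N = 1"
    using power_card_minus_1_eq_1[OF x0] by (simp only: power_int_of_nat)
  have "card {0, 1::'a} \<le> CARD('a)"
    by (rule card_mono) auto
  then have Npos: "?N > 0"
    by simp
  \<comment> \<open>Exponents matter only modulo such an \<open>r\<close>, so at most
    \<open>r\<close> distinct powers must cover all \<open>?N\<close> units.\<close>
  have min: "?N \<le> r" if "r > 0" "x powi r = 1" for r
  proof -
    have "UNIV - {0} \<subseteq> (\<lambda>n. x powi n) ` {0..<r}"
    proof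
      fix y assume "y \<in> UNIV - {0::'a}"
      then obtain e where "y = x powi e"
        using gen unfolding generates_units_def cyclic_subgroup_def by blast
      then have "y = x powi (e mod r)"
        using power_int_mod_eq[OF x0 that(2)] by simp
      then show "y \<in> (\<lambda>n. x powi n) ` {0..<r}"
        using that(1) by auto
    qed
    then have "card (UNIV - {0::'a}) \<le> card {0..<r}"
      by (meson finite_atLeastLessThan_int surj_card_le)
    then show ?thesis
      using that(1) by (simp add: card_Diff_singleton)
  qed
  show ?thesis
  proof
    assume "x powi n = 1"
    then have "x powi (n mod ?N) = 1"
      using power_int_mod_eq[OF x0 xN] by simp
    moreover have "0 \<le> n mod ?N" "n mod ?N < ?N"
      using Npos by simp_all
    ultimately show "?N dvd n"
      using min[of "n mod ?N"] by (cases "n mod ?N = 0") auto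
  next
    assume "?N dvd n"
    then show "x powi n = 1"
      using xN by (auto simp only: dvd_def power_int_mult power_int_1_left)
  qed
qed

text \<open>This yields the exact order of \<phi>: the criterion for \<open>x\<close> is applied to
  the exponent \<open>m * n\<close>, and \<open>m\<close> is cancelled.\<close>

lemma generates_units_power_power_int_eq_1_iff:
  fixes x :: "'a::{field,finite}"
  assumes "generates_units x" "k * m = CARD('a) - 1" "m > 0"
  shows "(x ^ m) powi n = 1 \<longleftrightarrow> int k dvd n"
proof -
  have "(x ^ m) powi n = x powi (int m * n)"
    by (simp only: power_int_mult power_int_of_nat)
  also have "\<dots> = 1 \<longleftrightarrow> int m * int k dvd int m * n"
    unfolding generates_units_power_int_eq_1_iff[OF assms(1)] assms(2)[symmetric]
    by (simp add: mult.commute)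
  finally show ?thesis
    using assms(3) by simp
qed

section \<open>Cyclic subgroups, their exponents and the constants \<open>cconst\<close>\<close>

lemma cyclic_subgroup_mult:
  assumes "x \<noteq> 0" "g \<in> cyclic_subgroup x" "h \<in> cyclic_subgroup x"
  shows "g * h \<in> cyclic_subgroup x"
  using assms unfolding cyclic_subgroup_def by (auto simp flip: power_int_add)

lemma cyclic_subgroup_divide:
  assumes "x \<noteq> 0" "g \<in> cyclic_subgroup x" "h \<in> cyclic_subgroup x"
  shows "g / h \<in> cyclic_subgroup x"
  using assms unfolding cyclic_subgroup_def by (auto simp flip: power_int_diff)

lemma power_int_in_cyclic_subgroup: "x powi n \<in> cyclic_subgroup x"
  by (simp add: cyclic_subgroup_def)

lemma cyclic_subgroup_nonzero:
  assumes "x \<noteq> 0" "g \<in> cyclic_subgroup x"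
  shows "g \<noteq> 0"
  using assms by (auto simp: cyclic_subgroup_def)

text \<open>Supplies the indices \<open>i\<close> and \<open>j\<close>: an exponent is reduced
  modulo \<open>k\<close>, and the residue 0 would give \<open>g = 1\<close>.\<close>

lemma cyclic_subgroup_nontrivial_exponent:
  fixes x :: "'a::field"
  assumes "x \<noteq> 0" "x powi int k = 1" "k > 0" "g \<in> cyclic_subgroup x" "g \<noteq> 1"
  obtains n where "n \<in> {1..int k - 1}" "g = x powi n"
proof -
  obtain e where e: "g = x powi e"
    using assms(4) unfolding cyclic_subgroup_def by blast
  then have g: "g = x powi (e mod int k)"
    using power_int_mod_eq[OF assms(1,2)] by simp
  with assms(5) have "e mod int k \<noteq> 0"
    by auto
  moreover have "0 \<le> e mod int k" "e mod int k < int k"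
    using assms(3) by simp_all
  ultimately show thesis
    using that[of "e mod int k"] g by auto
qed

lemma cconst_eq_power_int:
  fixes x :: "'a::field"
  assumes "x \<noteq> 0" "x powi int k = 1" "k > 0"
  shows "cconst x k j i = (x powi i - 1) / (x powi j - 1)"
proof -
  have "x ^ nat (n mod int k) = x powi n" for n
  proof -
    have "x ^ nat (n mod int k) = x powi (n mod int k)"
      using assms(3) by (simp flip: power_int_of_nat)
    then show ?thesis
      using power_int_mod_eq[OF assms(1,2)] by simp
  qed
  then show ?thesis
    by (simp add: cconst_def divide_inverse mult.commute)
qed

section \<open>Counting the intersection through solutions of linear equations\<close>

lemma mem_bracket_set_iff:
  "y \<in> H \<inter> (\<lambda>x. x + c) ` mult_coset H a \<longleftrightarrow> y \<in> H \<and> (\<exists>h\<in>H. y = h * a + c)"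
  by (auto simp: mult_coset_def)

lemma bracket_pos_iff:
  fixes a c :: "'a::{field,finite}"
  shows "bracket H a c > 0 \<longleftrightarrow> (\<exists>\<psi>\<in>H. \<exists>h\<in>H. \<psi> = h * a + c)"
  unfolding bracket_def card_gt_0_iff using mem_bracket_set_iff[of _ H c a] by auto

lemma bracket_ge_2_iff:
  fixes a c :: "'a::{field,finite}"
  shows "bracket H a c \<ge> 2 \<longleftrightarrow>
    (\<exists>\<psi>\<in>H. \<exists>\<psi>'\<in>H. \<exists>h\<in>H. \<exists>h'\<in>H. \<psi> \<noteq> \<psi>' \<and> \<psi> = h * a + c \<and> \<psi>' = h' * a + c)"
proof -
  let ?S = "H \<inter> (\<lambda>x. x + c) ` mult_coset H a"
  have "bracket H a c \<ge> 2 \<longleftrightarrow> \<not> card ?S \<le> Suc 0"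
    by (auto simp: bracket_def)
  also have "\<dots> \<longleftrightarrow> (\<exists>\<psi>\<in>?S. \<exists>\<psi>'\<in>?S. \<psi> \<noteq> \<psi>')"
    by (subst card_le_Suc0_iff_eq) auto
  finally show ?thesis
    unfolding Bex_def mem_bracket_set_iff by blast
qed

text \<open>The equation \<open>\<psi> = h * a + c\<close> is solved for \<open>a\<close>, using
  that \<open>H\<close> is closed under inverses; \<open>a \<noteq> 0\<close> forces
  \<open>\<psi> \<noteq> c\<close>.\<close>

lemma bracket_pos_iff_coset:
  fixes a c x :: "'a::{field,finite}"
  assumes x0: "x \<noteq> 0" and a0: "a \<noteq> 0"
  defines "H \<equiv> cyclic_subgroup x"
  shows "bracket H a c > 0 \<longleftrightarrow> (\<exists>\<psi>\<in>H - {c}. a \<in> mult_coset H (\<psi> - c))"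
proof -
  \<comment> \<open>The inverse arises as the quotient of \<open>x powi 0 = 1\<close> by
    \<open>h\<close>.\<close>
  have inv: "inverse h \<in> H" "h \<noteq> 0" if "h \<in> H" for h
    using that cyclic_subgroup_divide[OF x0 power_int_in_cyclic_subgroup[of x 0], of h]
      cyclic_subgroup_nonzero[OF x0, of h]
    by (simp_all add: H_def divide_inverse)
  show ?thesis
    unfolding bracket_pos_iff
  proof
    assume "\<exists>\<psi>\<in>H. \<exists>h\<in>H. \<psi> = h * a + c"
    then obtain \<psi> h where *: "\<psi> \<in> H" "h \<in> H" "\<psi> = h * a + c"
      by blast
    then have "\<psi> \<noteq> c" "a = inverse h * (\<psi> - c)"
      using inv a0 by auto
    then show "\<exists>\<psi>\<in>H - {c}. a \<in> mult_coset H (\<psi> - c)"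
      using * inv unfolding mult_coset_def by blast
  next
    assume "\<exists>\<psi>\<in>H - {c}. a \<in> mult_coset H (\<psi> - c)"
    then obtain \<psi> h where *: "\<psi> \<in> H" "h \<in> H" "a = h * (\<psi> - c)"
      unfolding mult_coset_def by blast
    then have "\<psi> = inverse h * a + c"
      using inv(2)[OF *(2)] by (simp flip: mult.assoc)
    then show "\<exists>\<psi>\<in>H. \<exists>h\<in>H. \<psi> = h * a + c"
      using * inv by blast
  qed
qed

lemma bracket_ge_2_iff_coset:
  fixes a c x :: "'a::{field,finite}"
  assumes x0: "x \<noteq> 0" and ord: "\<And>n. x powi n = 1 \<longleftrightarrow> int k dvd n" and k: "k > 0"
    and c0: "c \<noteq> 0"
  defines "H \<equiv> cyclic_subgroup x"
  shows "bracket H a c \<ge> 2 \<longleftrightarrow>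
    (\<exists>i\<in>{1..int k - 1}. \<exists>j\<in>{1..int k - 1}. i \<noteq> j \<and>
      a \<in> mult_coset H (cconst x k j i) \<and> c \<in> mult_coset H (cconst x k j (j - i)))"
    (is "_ \<longleftrightarrow> ?R")
proof -
  have xk: "x powi int k = 1"
    by (simp only: ord dvd_refl)
  note cconst = cconst_eq_power_int[OF x0 xk k]
  note mult = cyclic_subgroup_mult[OF x0, folded H_def]
  note div = cyclic_subgroup_divide[OF x0, folded H_def]
  note nz = cyclic_subgroup_nonzero[OF x0, folded H_def]
  note pw = power_int_in_cyclic_subgroup[of x, folded H_def]
  note obt = cyclic_subgroup_nontrivial_exponent[OF x0 xk k, folded H_def]
  have ne: "x powi n \<noteq> 1" if "n \<in> {1..int k - 1}" for n
    using that zdvd_imp_le[of "int k" n] by (auto simp: ord)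
  show ?thesis
    unfolding bracket_ge_2_iff
  proof
    assume "\<exists>\<psi>\<in>H. \<exists>\<psi>'\<in>H. \<exists>h\<in>H. \<exists>h'\<in>H.
      \<psi> \<noteq> \<psi>' \<and> \<psi> = h * a + c \<and> \<psi>' = h' * a + c"
    then obtain \<psi> \<psi>' h h' where H: "\<psi> \<in> H" "\<psi>' \<in> H" "h \<in> H" "h' \<in> H"
      and neq: "\<psi> \<noteq> \<psi>'" and eq: "\<psi> = h * a + c" "\<psi>' = h' * a + c"
      by blast
    have z: "\<psi> \<noteq> 0" "h \<noteq> 0"
      using H nz by auto
    obtain i where i: "i \<in> {1..int k - 1}" "\<psi>' / \<psi> = x powi i"
      using obt[OF div[OF H(2,1)]] neq z by auto
    \<comment> \<open>Here \<open>h' = h\<close> would make the two elements \<psi> and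
      \<open>\<psi>'\<close> equal.\<close>
    obtain j where j: "j \<in> {1..int k - 1}" "h' / h = x powi j"
      using obt[OF div[OF H(4,3)]] neq eq z by auto
    define u v where "u = x powi i" and "v = x powi j"
    have uv: "\<psi>' = \<psi> * u" "h' = h * v" "u \<noteq> 0" "v \<noteq> 1"
      using i j z x0 ne by (auto simp: u_def v_def field_simps)
    \<comment> \<open>Subtracting the two equations eliminates \<open>c\<close>.\<close>
    have "h * a * (v - 1) = \<psi> * (u - 1)"
      using eq unfolding uv by (simp add: algebra_simps)
    then have a: "a = \<psi> / h * ((u - 1) / (v - 1))"
      using z uv by (simp add: field_simps)
    have "c = \<psi> - h * a"
      using eq by simp
    also have "\<dots> = \<psi> * u * ((v / u - 1) / (v - 1))"
      unfolding a using z uv by (simp add: field_simps)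
    finally have c: "c = \<psi> * u * ((v / u - 1) / (v - 1))" .
    \<comment> \<open>If \<open>i = j\<close>, then \<open>v / u = 1\<close> and \<open>c\<close>
      would vanish.\<close>
    then have "i \<noteq> j"
      using c0 uv by (auto simp: u_def v_def)
    moreover have "a \<in> mult_coset H (cconst x k j i)"
      using a H div unfolding mult_coset_def cconst u_def v_def by blast
    moreover have "c \<in> mult_coset H (cconst x k j (j - i))"
      using c H mult pw x0 unfolding mult_coset_def cconst u_def v_def
      by (auto simp: power_int_diff)
    ultimately show ?R
      using i(1) j(1) by blast
  next
    assume ?R
    then obtain i j s t where i: "i \<in> {1..int k - 1}" and j: "j \<in> {1..int k - 1}"
      and st: "s \<in> H" "t \<in> H"
      and ac: "a = s * cconst x k j i" "c = t * cconst x k j (j - i)"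
      unfolding mult_coset_def by blast
    define u v where "u = x powi i" and "v = x powi j"
    have uv: "u \<noteq> 0" "v \<noteq> 1" "u \<noteq> 1" "u \<in> H" "v \<in> H"
      using i j x0 ne pw by (auto simp: u_def v_def)
    have z: "s \<noteq> 0" "t \<noteq> 0"
      using st nz by auto
    have a: "a = s * ((u - 1) / (v - 1))" and c: "c = t * ((v / u - 1) / (v - 1))"
      using ac x0 by (simp_all add: cconst u_def v_def power_int_diff)
    have "v - 1 \<noteq> 0"
      using uv by simp
    \<comment> \<open>The forward direction had coset factors \<open>s = \<psi> / h\<close> and
      \<open>t = \<psi> * u\<close>. Solving these for \<psi> and \<open>h\<close> gives
      \<open>\<psi> = t / u\<close>, \<open>h = t / u / s\<close>, hence \<open>\<psi>' = t\<close>
      and \<open>h' = t / u / s * v\<close>.\<close>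
    have "t / u = t / u / s * a + c"
      unfolding a c using z uv \<open>v - 1 \<noteq> 0\<close> by (simp add: divide_simps) (simp add: algebra_simps)
    moreover have "t = t / u / s * v * a + c"
      unfolding a c using z uv \<open>v - 1 \<noteq> 0\<close> by (simp add: divide_simps) (simp add: algebra_simps)
    moreover have "t / u \<noteq> t"
      using z uv by (simp add: field_simps)
    moreover have "t / u \<in> H" "t / u / s \<in> H" "t / u / s * v \<in> H"
      using st uv mult div by auto
    ultimately show "\<exists>\<psi>\<in>H. \<exists>\<psi>'\<in>H. \<exists>h\<in>H. \<exists>h'\<in>H.
      \<psi> \<noteq> \<psi>' \<and> \<psi> = h * a + c \<and> \<psi>' = h' * a + c"
      using st(2) by blast
  qed
qed

theorem theorem13:
  fixes q k m :: nat
    and \<zeta> \<phi> a c :: "'a::{field,finite}"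
    and \<Phi> :: "'a set"
  assumes "primepow q" and "CARD('a) = q"
    and "k \<ge> 3" and "k dvd (q - 1)" and "m = (q - 1) div k"
    and "generates_units \<zeta>"
    and "\<phi> = \<zeta> ^ m" and "\<Phi> = cyclic_subgroup \<phi>"
    and "a \<noteq> 0" and "c \<noteq> 0"
  shows "(bracket \<Phi> a c > 0 \<longleftrightarrow> (\<exists>\<psi> \<in> \<Phi> - {c}. a \<in> mult_coset \<Phi> (\<psi> - c)))
       \<and> (bracket \<Phi> a c \<ge> 2 \<longleftrightarrow>
           (\<exists>i \<in> {1..int k - 1}. \<exists>j \<in> {1..int k - 1}. i \<noteq> j \<and>
              a \<in> mult_coset \<Phi> (cconst \<phi> k j i) \<and>
              c \<in> mult_coset \<Phi> (cconst \<phi> k j (j - i))))"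
proof -
  have \<phi>0: "\<phi> \<noteq> 0"
    using generates_units_nonzero[OF assms(6)] assms(7) by simp
  have km: "k * m = CARD('a) - 1"
    using assms(2,4,5) by simp
  moreover have "CARD('a) > 1"
    using primepow_gt_Suc_0[OF assms(1)] assms(2) by simp
  \<comment> \<open>The product \<open>k * m\<close> is the number of units, which is
    positive.\<close>
  ultimately have "m > 0"
    by (cases m) auto
  then have ord: "\<phi> powi n = 1 \<longleftrightarrow> int k dvd n" for n
    unfolding assms(7) by (rule generates_units_power_power_int_eq_1_iff[OF assms(6) km])
  have "k > 0"
    using assms(3) by simp
  then show ?thesis
    unfolding assms(8)
    using bracket_pos_iff_coset[OF \<phi>0 assms(9)] bracket_ge_2_iff_coset[OF \<phi>0 ord _ assms(10)]
    by blast
qed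

end
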